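(* Let $A\in\mathbb{R}^{n\times n}$, $q\in\mathbb{R}^n$, and suppose that the set $\mathcal{F}_1$ is nonempty. Suppose that for a given $y^{(0)}\in\mathcal{F}_1$, $0$ is a regular value of the map $(y,\lambda)\mapsto H(y,y^{(0)},\lambda)$. Then the homotopy path $\Gamma_y^{(0)}\subset\mathcal{F}_1\times(0,1]$ is bounded.
   Context: Let $\mathcal{F}=\{x\in\mathbb{R}^n : x>0,\ Ax+q>0\}$ (componentwise inequalities) and $\mathcal{F}_1=\mathcal{F}\times\mathbb{R}^n_{++}\times\mathbb{R}^n_{++}$, where $\mathbb{R}^n_{++}$ is the set of vectors with all components positive. $A^t$ denotes the transpose of $A$. For $y=(x,z_1,z_2)\in\mathbb{R}^n\times\mathbb{R}^n\times\mathbb{R}^n$, $y^{(0)}=(x^{(0)},z_1^{(0)},z_2^{(0)})\in\mathcal{F}_1$ and $\lambda\in(0,1]$, the homotopy function is $$H(y,y^{(0)},\lambda)=\begin{bmatrix}(1-\lambda)[(A+A^t)x+q-z_1-A^tz_2]+\lambda(x-x^{(0)})\\ Z_1x-\lambda Z_1^{(0)}x^{(0)}\\ Z_2(Ax+q)-\lambda Z_2^{(0)}(Ax^{(0)}+q)\end{bmatrix},$$ where $Z_i=\mathrm{diag}(z_i)$ and $Z_i^{(0)}=\mathrm{diag}(z_i^{(0)})$ for $i=1,2$. A point $v\in\mathbb{R}^p$ is a regular value of a smooth map $f$ into $\mathbb{R}^p$ if the range of $Df(u)$ is all of $\mathbb{R}^p$ for every $u\in f^{-1}(v)$. The homotopy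 path $\Gamma_y^{(0)}$ is the curve starting from $(y^{(0)},1)$ (the connected component containing $(y^{(0)},1)$) in the zero set $\{(y,\lambda)\in\mathcal{F}_1\times(0,1] : H(y,y^{(0)},\lambda)=0\}$. *)

theory Defs
  imports "HOL-Analysis.Analysis"
begin

text \<open>
  Strict positivity is spelled out componentwise: the library order \<open><\<close> on
  \<open>real ^ 'n\<close> only means ``\<open>\<le>\<close> and not equal''.
\<close>

definition pos_orthant :: "(real ^ 'n) set" where
  "pos_orthant = {x. \<forall>i. 0 < x $ i}"

definition feasible :: "real ^ 'n ^ 'n \<Rightarrow> real ^ 'n \<Rightarrow> (real ^ 'n) set" where
  "feasible A q = {x. x \<in> pos_orthant \<and> A *v x + q \<in> pos_orthant}"

definition feasible1 ::
  "real ^ 'n ^ 'n \<Rightarrow> real ^ 'n \<Rightarrow> ((real ^ 'n) \<times> (real ^ 'n) \<times> (real ^ 'n)) set" where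
  "feasible1 A q = feasible A q \<times> pos_orthant \<times> pos_orthant"

definition diag :: "real ^ 'n \<Rightarrow> real ^ 'n ^ 'n" where
  "diag z = (\<chi> i j. if i = j then z $ i else 0)"

text \<open>The three block rows of the homotopy are the components of a triple.\<close>

definition homotopy_fun ::
  "real ^ 'n ^ 'n \<Rightarrow> real ^ 'n
    \<Rightarrow> (real ^ 'n) \<times> (real ^ 'n) \<times> (real ^ 'n)
    \<Rightarrow> (real ^ 'n) \<times> (real ^ 'n) \<times> (real ^ 'n)
    \<Rightarrow> real \<Rightarrow> (real ^ 'n) \<times> (real ^ 'n) \<times> (real ^ 'n)" where
  "homotopy_fun A q = (\<lambda>(x, z1, z2) (x0, z10, z20) l.
     ((1 - l) *\<^sub>R ((A + transpose A) *v x + q - z1 - transpose A *v z2) + l *\<^sub>R (x - x0),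
      diag z1 *v x - l *\<^sub>R (diag z10 *v x0),
      diag z2 *v (A *v x + q) - l *\<^sub>R (diag z20 *v (A *v x0 + q))))"

text \<open>
  \<open>v\<close> is a regular value of \<open>f\<close> restricted to \<open>S\<close>. The derivative is the two-sided one of the
  ambient map, also at points of \<open>S\<close> on its boundary; the existential only names the
  derivative, which is unique.
\<close>

definition regular_value_on ::
  "'a::real_normed_vector set \<Rightarrow> ('a \<Rightarrow> 'b::real_normed_vector) \<Rightarrow> 'b \<Rightarrow> bool" where
  "regular_value_on S f v \<longleftrightarrow>
     (\<forall>u\<in>S. f u = v \<longrightarrow> (\<exists>f'. (f has_derivative f') (at u) \<and> range f' = UNIV))"

definition homotopy_zeros ::
  "real ^ 'n ^ 'n \<Rightarrow> real ^ 'n \<Rightarrow> (real ^ 'n) \<times> (real ^ 'n) \<times> (real ^ 'n)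
    \<Rightarrow> (((real ^ 'n) \<times> (real ^ 'n) \<times> (real ^ 'n)) \<times> real) set" where
  "homotopy_zeros A q y0 =
     {(y, l). y \<in> feasible1 A q \<and> l \<in> {0<..1} \<and> homotopy_fun A q y y0 l = 0}"

definition homotopy_path ::
  "real ^ 'n ^ 'n \<Rightarrow> real ^ 'n \<Rightarrow> (real ^ 'n) \<times> (real ^ 'n) \<times> (real ^ 'n)
    \<Rightarrow> (((real ^ 'n) \<times> (real ^ 'n) \<times> (real ^ 'n)) \<times> real) set" where
  "homotopy_path A q y0 = connected_component_set (homotopy_zeros A q y0) (y0, 1)"

text \<open>
  If \<open>(y0, 1)\<close> were not in the zero set, \<open>connected_component_set\<close> would return the empty set;
  this does not happen.
\<close>

lemma start_in_homotopy_path: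
  assumes "y0 \<in> feasible1 A q"
  shows "(y0, 1) \<in> homotopy_path A q y0"
  using assms
  by (auto simp: homotopy_path_def homotopy_zeros_def homotopy_fun_def zero_prod_def
      split: prod.splits)

lemma homotopy_path_subset: "homotopy_path A q y0 \<subseteq> feasible1 A q \<times> {0<..1}"
  unfolding homotopy_path_def
  using connected_component_subset[of "homotopy_zeros A q y0" "(y0, 1)"]
  by (auto simp: homotopy_zeros_def)

end

theory Submission
  imports Defs
begin

text \<open>
  The whole zero set of the homotopy is bounded, hence so is each of its connected components.

  Write \<open>w = A x + q\<close>. On the zero set \<open>z1\<close> and \<open>z2\<close> are determined by complementarity:
  \<open>z1\<^sub>i x\<^sub>i = \<lambda> c\<^sub>i\<close> and \<open>z2\<^sub>i w\<^sub>i = \<lambda> d\<^sub>i\<close> with constants \<open>c\<^sub>i, d\<^sub>i > 0\<close> given by the starting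
  point. Everything else follows by testing the first block row with two vectors \<open>v\<close>, using
  \<open>v \<bullet> ((A + A\<^sup>T) x + q) = v \<bullet> w + x \<bullet> A v\<close>.

  \<^item> \<open>x\<close> is bounded. If \<open>x\<close> tends to infinity along a sequence of zeros, let \<open>u\<close> be a limit of
    \<open>x / \<bar>x\<bar>\<close>. Then \<open>u \<ge> 0\<close> and \<open>A u \<ge> 0\<close>, since \<open>x > 0\<close> and \<open>w > 0\<close>. For \<open>v = u\<close> the quadratic
    part \<open>u \<bullet> w + x \<bullet> A u\<close> is nonnegative, whatever \<open>A\<close> is, so the term \<open>\<lambda> u \<bullet> (x - x0)\<close>, of order
    \<open>\<lambda> \<bar>x\<bar>\<close>, has to be balanced by \<open>z1 \<bullet> u + z2 \<bullet> A u = \<lambda> (\<Sum> c\<^sub>i u\<^sub>i / x\<^sub>i + \<Sum> d\<^sub>i (A u)\<^sub>i / w\<^sub>i)\<close>. The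
    factor \<open>\<lambda>\<close> cancels, which makes the estimate uniform as \<open>\<lambda>\<close> tends to 0, and the remaining sums
    tend to 0 because \<open>x\<^sub>i\<close> tends to infinity wherever \<open>u\<^sub>i > 0\<close>, and likewise for \<open>w\<close>.

  \<^item> \<open>z1\<close> and \<open>z2\<close> are bounded. For \<open>\<lambda> < 1\<close> and \<open>v = x - x0\<close>, complementarity bounds
    \<open>z1 \<bullet> x + z2 \<bullet> w\<close> by a constant and leaves \<open>z1 \<bullet> x0 + z2 \<bullet> w0\<close> bounded in terms of \<open>x\<close>; the
    coefficients \<open>x0, w0\<close> are positive. For \<open>\<lambda> = 1\<close> the only zero is the starting point.
\<close>

section \<open>Equations satisfied on the zero set\<close>

lemma diag_mult_vec_nth: "(diag z *v x) $ i = z $ i * x $ i"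
proof -
  have "(diag z *v x) $ i = (\<Sum>j\<in>UNIV. if i = j then z $ i * x $ j else 0)"
    unfolding diag_def matrix_vector_mult_def vec_lambda_beta by (rule sum.cong) auto
  then show ?thesis by simp
qed

lemma inner_transpose_mult_vec:
  fixes A :: "real ^ 'n ^ 'n"
  shows "v \<bullet> (transpose A *v x) = x \<bullet> (A *v v)"
  by (metis dot_lmul_matrix inner_commute transpose_matrix_vector)

lemma homotopy_zerosD:
  assumes "((x, z1, z2), l) \<in> homotopy_zeros A q (x0, z10, z20)"
  shows "0 < l" "l \<le> 1"
    and "\<And>i. 0 < x $ i" "\<And>i. 0 < (A *v x + q) $ i" "\<And>i. 0 < z1 $ i" "\<And>i. 0 < z2 $ i"
    and "\<And>i. z1 $ i * x $ i = l * (z10 $ i * x0 $ i)"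
    and "\<And>i. z2 $ i * (A *v x + q) $ i = l * (z20 $ i * (A *v x0 + q) $ i)"
    and "(1 - l) *\<^sub>R ((A + transpose A) *v x + q - z1 - transpose A *v z2) + l *\<^sub>R (x - x0) = 0"
proof -
  from assms have f: "(x, z1, z2) \<in> feasible1 A q" and l: "l \<in> {0<..1}"
    and h: "homotopy_fun A q (x, z1, z2) (x0, z10, z20) l = 0"
    by (auto simp: homotopy_zeros_def)
  show "0 < l" "l \<le> 1" using l by auto
  show "\<And>i. 0 < x $ i" "\<And>i. 0 < (A *v x + q) $ i" "\<And>i. 0 < z1 $ i" "\<And>i. 0 < z2 $ i"
    using f by (auto simp: feasible1_def feasible_def pos_orthant_def)
  from h show "(1 - l) *\<^sub>R ((A + transpose A) *v x + q - z1 - transpose A *v z2)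
      + l *\<^sub>R (x - x0) = 0"
    by (simp add: homotopy_fun_def zero_prod_def)
  from h have "diag z1 *v x = l *\<^sub>R (diag z10 *v x0)"
    and "diag z2 *v (A *v x + q) = l *\<^sub>R (diag z20 *v (A *v x0 + q))"
    by (simp_all add: homotopy_fun_def zero_prod_def)
  then show "\<And>i. z1 $ i * x $ i = l * (z10 $ i * x0 $ i)"
    and "\<And>i. z2 $ i * (A *v x + q) $ i = l * (z20 $ i * (A *v x0 + q) $ i)"
    by (metis diag_mult_vec_nth vector_scaleR_component real_scaleR_def)+
qed

lemma homotopy_zeros_tested:
  assumes "((x, z1, z2), l) \<in> homotopy_zeros A q (x0, z10, z20)"
  shows "(1 - l) * (v \<bullet> (A *v x + q) + x \<bullet> (A *v v) - z1 \<bullet> v - z2 \<bullet> (A *v v))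
           + l * (v \<bullet> (x - x0)) = 0"
proof -
  have "v \<bullet> ((1 - l) *\<^sub>R ((A + transpose A) *v x + q - z1 - transpose A *v z2)
      + l *\<^sub>R (x - x0)) = 0"
    using homotopy_zerosD(9)[OF assms] by simp
  then show ?thesis
    by (simp add: inner_add_right inner_diff_right matrix_vector_mult_add_rdistrib
        inner_transpose_mult_vec inner_commute[of z1 v] add.commute add.left_commute
        del: transpose_matrix_vector)
qed

section \<open>The primal variable is bounded\<close>

text \<open>
  Both \<open>u \<bullet> (A x + q)\<close> and \<open>x \<bullet> A u\<close> are nonnegative, so the tested equation bounds
  \<open>\<lambda> u \<bullet> (x - x0)\<close> by \<open>z1 \<bullet> u + z2 \<bullet> A u\<close>, which complementarity makes proportional to \<open>\<lambda>\<close>. The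
  conclusion no longer contains \<open>\<lambda>\<close>.
\<close>

lemma homotopy_zeros_recession_bound:
  assumes z: "((x, z1, z2), l) \<in> homotopy_zeros A q (x0, z10, z20)"
    and u: "\<And>i. 0 \<le> u $ i" and Au: "\<And>i. 0 \<le> (A *v u) $ i"
  shows "u \<bullet> (x - x0) \<le> (\<Sum>i\<in>UNIV. z10 $ i * x0 $ i * (u $ i / x $ i))
           + (\<Sum>i\<in>UNIV. z20 $ i * (A *v x0 + q) $ i * ((A *v u) $ i / (A *v x + q) $ i))"
    (is "_ \<le> ?S1 + ?S2")
proof -
  note D = homotopy_zerosD[OF z]
  have z1: "z1 \<bullet> u = l * ?S1"
    unfolding inner_vec_def sum_distrib_left
  proof (rule sum.cong)
    fix i
    have "z1 $ i = l * (z10 $ i * x0 $ i) / x $ i"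
      using D(3)[of i] D(7)[of i] by (simp add: field_simps)
    then show "z1 $ i \<bullet> u $ i = l * (z10 $ i * x0 $ i * (u $ i / x $ i))" by simp
  qed simp
  have z2: "z2 \<bullet> (A *v u) = l * ?S2"
    unfolding inner_vec_def sum_distrib_left
  proof (rule sum.cong)
    fix i
    have "z2 $ i = l * (z20 $ i * (A *v x0 + q) $ i) / (A *v x + q) $ i"
      using D(4)[of i] D(8)[of i] by (simp del: vector_add_component add: eq_divide_eq)
    then show "z2 $ i \<bullet> (A *v u) $ i
        = l * (z20 $ i * (A *v x0 + q) $ i * ((A *v u) $ i / (A *v x + q) $ i))"
      by simp
  qed simp
  have nonneg: "0 \<le> u \<bullet> (A *v x + q)" "0 \<le> x \<bullet> (A *v u)" "0 \<le> z1 \<bullet> u" "0 \<le> z2 \<bullet> (A *v u)"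
    unfolding inner_vec_def inner_real_def using u Au D(3-6)
    by (auto intro!: sum_nonneg mult_nonneg_nonneg simp: less_imp_le simp del: vector_add_component)
  have "l * (u \<bullet> (x - x0))
      = (1 - l) * (z1 \<bullet> u + z2 \<bullet> (A *v u)) - (1 - l) * (u \<bullet> (A *v x + q) + x \<bullet> (A *v u))"
    using homotopy_zeros_tested[OF z, of u] by (simp add: algebra_simps)
  also have "\<dots> \<le> (1 - l) * (z1 \<bullet> u + z2 \<bullet> (A *v u))"
    using nonneg D(2) by simp
  also have "\<dots> \<le> z1 \<bullet> u + z2 \<bullet> (A *v u)"
    using nonneg D(1,2) by (intro mult_left_le_one_le) auto
  also have "\<dots> = l * (?S1 + ?S2)"
    by (simp only: z1 z2 distrib_left)
  finally show ?thesis using D(1) by simp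
qed

text \<open>
  For \<open>a \<noteq> 0\<close> the sequence \<open>y\<close> grows like \<open>a r\<close>. For \<open>a = 0\<close> it may have any slower behaviour, even
  tend to 0, but then the numerator vanishes. This covers the coordinates of \<open>x\<close> and \<open>w\<close> that
  grow more slowly than the norm of \<open>x\<close>.
\<close>

lemma tendsto_divide_of_linear_growth:
  fixes y r :: "nat \<Rightarrow> real"
  assumes lim: "(\<lambda>k. y k / r k) \<longlonglongrightarrow> a" and inv: "(\<lambda>k. 1 / r k) \<longlonglongrightarrow> 0"
    and r: "\<And>k. r k \<noteq> 0"
  shows "(\<lambda>k. a / y k) \<longlonglongrightarrow> 0"
proof (cases "a = 0")
  case False
  have "(\<lambda>k. a / (y k / r k) * (1 / r k)) \<longlonglongrightarrow> a / a * 0"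
    by (intro tendsto_intros lim inv False)
  moreover have "a / (y k / r k) * (1 / r k) = a / y k" for k
    using r[of k] by simp
  ultimately show ?thesis by simp
qed simp

lemma homotopy_zeros_primal_bounded:
  "\<exists>R. \<forall>x z1 z2 l. ((x, z1, z2), l) \<in> homotopy_zeros A q (x0, z10, z20) \<longrightarrow> norm x \<le> R"
proof (rule ccontr)
  assume "\<not> ?thesis"
  then have "\<forall>k::nat. \<exists>x. (\<exists>z1 z2 l. ((x, z1, z2), l) \<in> homotopy_zeros A q (x0, z10, z20))
      \<and> real k + 1 < norm x"
    by (meson not_le)
  then obtain X where X: "\<And>k::nat. \<exists>z1 z2 l.
        ((X k, z1, z2), l) \<in> homotopy_zeros A q (x0, z10, z20)"
    and big: "\<And>k::nat. real k + 1 < norm (X k)"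
    by metis
  have "X k /\<^sub>R norm (X k) \<in> sphere 0 1" for k
  proof -
    have "norm (X k) \<noteq> 0" using big[of k] by linarith
    then show ?thesis by simp
  qed
  moreover have "seq_compact (sphere (0 :: real ^ 'a) 1)"
    using compact_imp_seq_compact compact_sphere by blast
  ultimately obtain u s where u: "u \<in> sphere 0 1" and s: "strict_mono (s :: nat \<Rightarrow> nat)"
    and lim: "((\<lambda>k. X k /\<^sub>R norm (X k)) \<circ> s) \<longlonglongrightarrow> u"
    unfolding seq_compact_def by meson
  define x where "x k = X (s k)" for k
  define r where "r k = norm (x k)" for k
  have r: "real k + 1 < r k" for k
    using big[of "s k"] seq_suble[OF s, of k] by (simp add: r_def x_def)
  have r_pos: "0 < r k" for k
    using r[of k] by linarith
  have zeros: "\<exists>z1 z2 l. ((x k, z1, z2), l) \<in> homotopy_zeros A q (x0, z10, z20)" for k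
    unfolding x_def by (rule X)
  have lim_x: "(\<lambda>k. x k /\<^sub>R r k) \<longlonglongrightarrow> u"
    using lim by (simp add: o_def x_def r_def)
  have inv: "(\<lambda>k. 1 / r k) \<longlonglongrightarrow> 0"
  proof (rule tendsto_sandwich[OF _ _ tendsto_const LIMSEQ_inverse_real_of_nat])
    show "\<forall>\<^sub>F k in sequentially. 0 \<le> 1 / r k"
      using r_pos by (simp add: less_imp_le)
    show "\<forall>\<^sub>F k in sequentially. 1 / r k \<le> inverse (real (Suc k))"
      using r by (intro always_eventually allI)
        (simp add: inverse_eq_divide frac_le less_imp_le add.commute)
  qed
  have lim_x_nth: "(\<lambda>k. x k $ i / r k) \<longlonglongrightarrow> u $ i" for i
    using tendsto_vec_nth[OF lim_x, of i] by (simp add: divide_inverse mult.commute)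
  have "(\<lambda>k. A *v (x k /\<^sub>R r k) + (1 / r k) *\<^sub>R q) \<longlonglongrightarrow> A *v u + 0 *\<^sub>R q"
    by (intro tendsto_intros inv
        bounded_linear.tendsto[OF matrix_vector_mul_bounded_linear lim_x])
  moreover have "A *v (x k /\<^sub>R r k) + (1 / r k) *\<^sub>R q = (A *v x k + q) /\<^sub>R r k" for k
    by (simp add: matrix_vector_mult_scaleR scaleR_add_right divide_inverse)
  ultimately have lim_w: "(\<lambda>k. (A *v x k + q) /\<^sub>R r k) \<longlonglongrightarrow> A *v u"
    by simp
  have lim_w_nth: "(\<lambda>k. (A *v x k + q) $ i / r k) \<longlonglongrightarrow> (A *v u) $ i" for i
    using tendsto_vec_nth[OF lim_w, of i]
    by (simp only: vector_scaleR_component real_scaleR_def divide_inverse mult.commute)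
  have x_pos: "0 < x k $ i" and w_pos: "0 < (A *v x k + q) $ i" for k i
    using zeros[of k] homotopy_zerosD(3,4) by blast+
  have u_nonneg: "0 \<le> u $ i" for i
    by (rule LIMSEQ_le_const[OF lim_x_nth]) (use x_pos r_pos in \<open>simp add: less_imp_le\<close>)
  have Au_nonneg: "0 \<le> (A *v u) $ i" for i
    by (rule LIMSEQ_le_const[OF lim_w_nth])
      (use w_pos r_pos in \<open>auto intro!: divide_nonneg_pos less_imp_le simp del: vector_add_component\<close>)
  define S where "S k = (\<Sum>i\<in>UNIV. z10 $ i * x0 $ i * (u $ i / x k $ i))
      + (\<Sum>i\<in>UNIV. z20 $ i * (A *v x0 + q) $ i * ((A *v u) $ i / (A *v x k + q) $ i))" for k
  have r_nz: "r k \<noteq> 0" for k using r_pos[of k] by simp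
  have "S \<longlonglongrightarrow> (\<Sum>i\<in>UNIV. z10 $ i * x0 $ i * 0) + (\<Sum>i\<in>UNIV. z20 $ i * (A *v x0 + q) $ i * 0)"
    unfolding S_def
    by (intro tendsto_add tendsto_sum tendsto_mult tendsto_const
        tendsto_divide_of_linear_growth[OF lim_x_nth inv r_nz]
        tendsto_divide_of_linear_growth[OF lim_w_nth inv r_nz])
  then have lim_S: "S \<longlonglongrightarrow> 0" by simp
  have "(\<lambda>k. u \<bullet> (x k /\<^sub>R r k) - (1 / r k) * (u \<bullet> x0)) \<longlonglongrightarrow> u \<bullet> u - 0 * (u \<bullet> x0)"
    by (intro tendsto_intros lim_x inv)
  moreover have "(\<lambda>k. (1 / r k) * S k) \<longlonglongrightarrow> 0 * 0"
    by (intro tendsto_intros lim_S inv)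
  moreover have "u \<bullet> (x k /\<^sub>R r k) - (1 / r k) * (u \<bullet> x0) \<le> (1 / r k) * S k" for k
  proof -
    have "u \<bullet> (x k - x0) \<le> S k"
      unfolding S_def using zeros[of k] homotopy_zeros_recession_bound u_nonneg Au_nonneg
      by blast
    then have "(1 / r k) * (u \<bullet> (x k - x0)) \<le> (1 / r k) * S k"
      using r_pos[of k] by (intro mult_left_mono) auto
    then show ?thesis
      by (simp add: inner_diff_right right_diff_distrib divide_inverse mult.commute)
  qed
  ultimately have "u \<bullet> u - 0 * (u \<bullet> x0) \<le> 0 * 0"
    by (intro LIMSEQ_le) auto
  then have "u \<bullet> u \<le> 0" by simp
  moreover have "u \<bullet> u = 1"
    using u by (simp add: dot_square_norm)
  ultimately show False by simp
qed

section \<open>The dual variables are bounded\<close>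

lemma homotopy_zeros_at_1:
  assumes z: "((x, z1, z2), 1) \<in> homotopy_zeros A q (x0, z10, z20)"
  shows "x = x0 \<and> z1 = z10 \<and> z2 = z20"
proof -
  note D = homotopy_zerosD[OF z]
  have x: "x = x0" using D(9) by simp
  have "z1 $ i = z10 $ i" "z2 $ i = z20 $ i" for i
    using D(3)[of i] D(4)[of i] D(7)[of i] D(8)[of i] unfolding x by auto
  then show ?thesis using x by (simp add: vec_eq_iff)
qed

text \<open>
  Testing with \<open>x - x0\<close> turns the regularization term into \<open>\<lambda>\<close> times a square. It has the same sign as
  the terms to be estimated and can be dropped; everything else carries the factor \<open>1 - \<lambda>\<close>, which
  therefore cancels without spoiling the bound as \<open>\<lambda>\<close> tends to 1.
\<close>

lemma homotopy_zeros_dual_sum: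
  assumes z: "((x, z1, z2), l) \<in> homotopy_zeros A q (x0, z10, z20)" and "l \<noteq> 1"
    and pos: "\<And>i. 0 < z10 $ i * x0 $ i" "\<And>i. 0 < z20 $ i * (A *v x0 + q) $ i"
  shows "z1 \<bullet> x0 + z2 \<bullet> (A *v x0 + q) \<le> z10 \<bullet> x0 + z20 \<bullet> (A *v x0 + q)
           - ((x - x0) \<bullet> (A *v x + q) + x \<bullet> (A *v (x - x0)))"
    (is "_ \<le> ?C - ?Q")
proof -
  note D = homotopy_zerosD[OF z]
  have l: "0 < 1 - l" using D(2) \<open>l \<noteq> 1\<close> by simp
  have "z1 \<bullet> x = l * (z10 \<bullet> x0)" "z2 \<bullet> (A *v x + q) = l * (z20 \<bullet> (A *v x0 + q))"
    by (simp_all only: inner_vec_def inner_real_def D(7) D(8) sum_distrib_left)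
  then have compl: "z1 \<bullet> x + z2 \<bullet> (A *v x + q) = l * ?C"
    by (simp add: distrib_left)
  have "0 \<le> ?C"
    unfolding inner_vec_def inner_real_def
    by (intro add_nonneg_nonneg sum_nonneg less_imp_le pos)
  then have "l * ?C \<le> ?C"
    using D(1,2) by (intro mult_left_le_one_le) auto
  have z1: "z1 \<bullet> (x - x0) = z1 \<bullet> x - z1 \<bullet> x0"
    by (simp add: inner_diff_right)
  have z2: "z2 \<bullet> (A *v (x - x0)) = z2 \<bullet> (A *v x + q) - z2 \<bullet> (A *v x0 + q)"
    by (simp add: inner_diff_right inner_add_right matrix_vector_mult_diff_distrib)
  have "(1 - l) * (?Q - z1 \<bullet> (x - x0) - z2 \<bullet> (A *v (x - x0))) = - (l * ((x - x0) \<bullet> (x - x0)))"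
    using homotopy_zeros_tested[OF z, of "x - x0"] by linarith
  also have "\<dots> \<le> 0" using D(1) by simp
  finally have "?Q - z1 \<bullet> (x - x0) - z2 \<bullet> (A *v (x - x0)) \<le> 0"
    using l by (simp add: mult_le_0_iff)
  then show ?thesis
    using z1 z2 compl \<open>l * ?C \<le> ?C\<close> by linarith
qed

text \<open>
  Each single term \<open>z\<^sub>i a\<^sub>i\<close> is at most the whole inner product, since all terms are nonnegative.
\<close>

lemma norm_le_weighted_inner:
  fixes a z :: "real ^ 'n"
  assumes a: "\<And>i. 0 < a $ i" and z: "\<And>i. 0 \<le> z $ i"
  shows "norm z \<le> (\<Sum>i\<in>UNIV. 1 / a $ i) * (z \<bullet> a)"
proof -
  have "norm z \<le> (\<Sum>i\<in>UNIV. \<bar>z $ i\<bar>)" by (rule norm_le_l1_cart)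
  also have "\<dots> \<le> (\<Sum>i\<in>UNIV. 1 / a $ i * (z \<bullet> a))"
  proof (rule sum_mono)
    fix i
    have "z $ i * a $ i \<le> z \<bullet> a"
      unfolding inner_vec_def inner_real_def
      by (rule member_le_sum) (use a z in \<open>auto intro: mult_nonneg_nonneg less_imp_le\<close>)
    then show "\<bar>z $ i\<bar> \<le> 1 / a $ i * (z \<bullet> a)"
      using a[of i] z[of i] by (simp add: field_simps)
  qed
  finally show ?thesis by (simp add: sum_distrib_right)
qed

lemma homotopy_zeros_bounded:
  assumes "y0 \<in> feasible1 A q"
  shows "bounded (homotopy_zeros A q y0)"
proof -
  obtain x0 z10 z20 where y0: "y0 = (x0, z10, z20)" by (metis prod.collapse)
  define w0 where "w0 = A *v x0 + q"
  have x0: "0 < x0 $ i" and w0: "0 < w0 $ i" and z10: "0 < z10 $ i" and z20: "0 < z20 $ i" for i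
    using assms unfolding y0 w0_def
    by (auto simp: feasible1_def feasible_def pos_orthant_def)
  obtain R where R: "\<And>x z1 z2 l. ((x, z1, z2), l) \<in> homotopy_zeros A q y0 \<Longrightarrow> norm x \<le> R"
    using homotopy_zeros_primal_bounded[of A q x0 z10 z20] unfolding y0 by blast
  define g where "g x = z10 \<bullet> x0 + z20 \<bullet> w0
      - ((x - x0) \<bullet> (A *v x + q) + x \<bullet> (A *v (x - x0)))" for x
  \<comment> \<open>The bound on the weighted dual sum is continuous in the primal variable, which ranges over
    a compact ball.\<close>
  have "continuous_on (cball 0 R) g"
    unfolding g_def
    by (intro continuous_intros
        bounded_linear.continuous_on[OF matrix_vector_mul_bounded_linear])
  then have "bounded (g ` cball 0 R)"
    by (intro compact_imp_bounded compact_continuous_image compact_cball)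
  then obtain G where G: "\<And>x. x \<in> cball 0 R \<Longrightarrow> \<bar>g x\<bar> \<le> G"
    unfolding bounded_iff by (metis image_eqI real_norm_def)
  define M where "M a = (\<Sum>i\<in>UNIV. 1 / a $ i)" for a :: "real ^ 'a"
  have M: "0 \<le> M x0" "0 \<le> M w0"
    using x0 w0 by (auto simp: M_def less_imp_le intro!: sum_nonneg)
  have dual: "norm z1 \<le> M x0 * G" "norm z2 \<le> M w0 * G"
    if z: "((x, z1, z2), l) \<in> homotopy_zeros A q y0" and "l \<noteq> 1" for x z1 z2 l
  proof -
    note D = homotopy_zerosD[OF z[unfolded y0]]
    have pos: "0 \<le> z1 $ i" "0 \<le> z2 $ i" for i
      using D(5,6) by (auto simp: less_imp_le)
    have "0 \<le> z1 \<bullet> x0" "0 \<le> z2 \<bullet> w0"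
      unfolding inner_vec_def inner_real_def
      using pos x0 w0 by (auto intro!: sum_nonneg mult_nonneg_nonneg simp: less_imp_le)
    moreover have "z1 \<bullet> x0 + z2 \<bullet> w0 \<le> g x"
      using homotopy_zeros_dual_sum[OF z[unfolded y0] \<open>l \<noteq> 1\<close>] x0 w0 z10 z20
      unfolding g_def w0_def by (simp del: vector_add_component)
    moreover have "g x \<le> G"
      using G[of x] R[OF z] by simp
    ultimately have "z1 \<bullet> x0 \<le> G" "z2 \<bullet> w0 \<le> G" by linarith+
    then show "norm z1 \<le> M x0 * G" "norm z2 \<le> M w0 * G"
      using norm_le_weighted_inner[of x0 z1, OF x0 pos(1)]
        norm_le_weighted_inner[of w0 z2, OF w0 pos(2)] M
      unfolding M_def[symmetric] by (meson mult_left_mono order_trans)+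
  qed
  have "homotopy_zeros A q y0
      \<subseteq> insert (y0, 1) ((cball 0 R \<times> cball 0 (M x0 * G) \<times> cball 0 (M w0 * G)) \<times> cball 0 1)"
  proof
    fix p assume p: "p \<in> homotopy_zeros A q y0"
    obtain x z1 z2 l where [simp]: "p = ((x, z1, z2), l)" by (metis prod.collapse)
    show "p \<in> insert (y0, 1)
        ((cball 0 R \<times> cball 0 (M x0 * G) \<times> cball 0 (M w0 * G)) \<times> cball 0 1)"
    proof (cases "l = 1")
      case True
      then show ?thesis using p homotopy_zeros_at_1[of x z1 z2 A q x0 z10 z20] y0 by simp
    next
      case False
      then show ?thesis
        using p R dual homotopy_zerosD(1,2)[of x z1 z2 l A q x0 z10 z20] y0 by fastforce
    qed
  qed
  then show ?thesis
    by (rule bounded_subset[rotated]) (intro bounded_insert[THEN iffD2] bounded_Times bounded_cball)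
qed

theorem theorem3p4:
  fixes A :: "real ^ 'n ^ 'n" and q :: "real ^ 'n"
    and y0 :: "(real ^ 'n) \<times> (real ^ 'n) \<times> (real ^ 'n)"
  assumes "feasible1 A q \<noteq> {}"
    and "y0 \<in> feasible1 A q"
    and "regular_value_on (feasible1 A q \<times> {0<..1}) (\<lambda>(y, l). homotopy_fun A q y y0 l) 0"
  shows "bounded (homotopy_path A q y0)"
  unfolding homotopy_path_def
  using homotopy_zeros_bounded[OF assms(2)] connected_component_subset by (rule bounded_subset)

end
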